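(* Let $W_1,\dots,W_M$ be subspaces of $\mathbb{R}^N$ with corresponding orthogonal projections $P_1,\dots,P_M$, and let $I_i=\dim W_i$. The following are equivalent: (1) $\{P_i\}_{i=1}^M$ does norm retrieval. (2) For every choice of orthonormal bases $\{\phi_{i,j}\}_{j=1}^{I_i}$ of $W_i$ ($1\le i\le M$) and every subset $S\subseteq\{(i,j):1\le i\le M,\ 1\le j\le I_i\}$, with complement $S^c$ in this index set, $$\big(\operatorname{span}\{\phi_{i,j}\}_{(i,j)\in S}\big)^\perp\ \perp\ \big(\operatorname{span}\{\phi_{i,j}\}_{(i,j)\in S^c}\big)^\perp .$$ (3) For every choice of orthonormal bases $\{\phi_{i,j}\}_{j=1}^{I_i}$ of $W_i$ ($1\le i\le M$), the collection of vectors $\{\phi_{i,j}\}_{(i,j)}$ does norm retrieval.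
   Context: A finite family of subspaces $\{W_i\}_{i=1}^M$ of $\mathbb{R}^N$ (or of the orthogonal projections $P_i$ onto them) does norm retrieval if, for all $x,y\in\mathbb{R}^N$, $\|P_ix\|=\|P_iy\|$ for all $i$ implies $\|x\|=\|y\|$. A finite family of vectors $\{\psi_k\}$ in $\mathbb{R}^N$ does norm retrieval if, for all $x,y\in\mathbb{R}^N$, $|\langle x,\psi_k\rangle|=|\langle y,\psi_k\rangle|$ for all $k$ implies $\|x\|=\|y\|$. For subspaces $A,B$, $A\perp B$ means $\langle a,b\rangle=0$ for all $a\in A$, $b\in B$. The span of the empty family is $\{0\}$. *)

theory Defs
  imports "HOL-Analysis.Analysis"
begin

definition orthogonal_projection_onto ::
    "'a::euclidean_space set \<Rightarrow> ('a \<Rightarrow> 'a) \<Rightarrow> bool" where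
  "orthogonal_projection_onto W P \<longleftrightarrow> (\<forall>x. P x \<in> W \<and> (\<forall>w\<in>W. orthogonal (x - P x) w))"

definition projections_norm_retrieval ::
    "'i set \<Rightarrow> ('i \<Rightarrow> 'a::euclidean_space \<Rightarrow> 'a) \<Rightarrow> bool" where
  "projections_norm_retrieval I P \<longleftrightarrow>
     (\<forall>x y. (\<forall>i\<in>I. norm (P i x) = norm (P i y)) \<longrightarrow> norm x = norm y)"

definition vectors_norm_retrieval ::
    "'k set \<Rightarrow> ('k \<Rightarrow> 'a::euclidean_space) \<Rightarrow> bool" where
  "vectors_norm_retrieval K \<psi> \<longleftrightarrow>
     (\<forall>x y. (\<forall>k\<in>K. \<bar>x \<bullet> \<psi> k\<bar> = \<bar>y \<bullet> \<psi> k\<bar>) \<longrightarrow> norm x = norm y)"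

definition orthonormal_basis_of ::
    "'a::euclidean_space set \<Rightarrow> 'j set \<Rightarrow> ('j \<Rightarrow> 'a) \<Rightarrow> bool" where
  "orthonormal_basis_of W J \<phi> \<longleftrightarrow>
     (\<forall>j\<in>J. \<forall>k\<in>J. \<phi> j \<bullet> \<phi> k = (if j = k then 1 else 0)) \<and> span (\<phi> ` J) = W"

definition orthogonal_sets :: "'a::euclidean_space set \<Rightarrow> 'a set \<Rightarrow> bool" where
  "orthogonal_sets A B \<longleftrightarrow> (\<forall>a\<in>A. \<forall>b\<in>B. orthogonal a b)"

definition basis_index_set :: "nat \<Rightarrow> (nat \<Rightarrow> 'a::euclidean_space set) \<Rightarrow> (nat \<times> nat) set" where
  "basis_index_set M W = (SIGMA i:{1..M}. {1..dim (W i)})"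

end

theory Submission
  imports Defs
begin

text \<open>
  Two identities explain the equivalence. The first is the polarisation
  \<open>(x - y) \<bullet> (x + y) = \<parallel>x\<parallel>\<^sup>2 - \<parallel>y\<parallel>\<^sup>2\<close>: equality of \<open>\<bar>x \<bullet> \<psi>\<bar>\<close> and \<open>\<bar>y \<bullet> \<psi>\<bar>\<close>
  means that \<open>\<psi>\<close> is orthogonal to \<open>x - y\<close> or to \<open>x + y\<close>, so a pair with equal measurements
  is the same thing as a pair \<open>u = x - y\<close>, \<open>v = x + y\<close> and a splitting of the vectors into
  those orthogonal to \<open>u\<close> and those orthogonal to \<open>v\<close>, and \<open>\<parallel>x\<parallel> = \<parallel>y\<parallel>\<close> says that
  \<open>u\<close> is orthogonal to \<open>v\<close>. Hence (2) and (3) agree for each choice of bases separately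
  (\<open>vectors_norm_retrieval_iff_orthogonal_comps\<close>).

  The second is Parseval's identity: \<open>\<parallel>P\<^sub>i x\<parallel>\<close> is determined by the numbers
  \<open>\<bar>x \<bullet> \<phi>\<^sub>i\<^sub>j\<bar>\<close> (\<open>norm_projection_eq_if_abs_inner_eq\<close>), so (1) implies (3).

  For the converse, the measurements \<open>\<parallel>P\<^sub>i x\<parallel> = \<parallel>P\<^sub>i y\<parallel>\<close> carry in general less information than
  those against any one basis, and the freedom in the choice of the bases makes up for it. By
  polarisation inside \<open>W\<^sub>i\<close>, the vectors \<open>P\<^sub>i x - P\<^sub>i y\<close> and \<open>P\<^sub>i x + P\<^sub>i y\<close> are orthogonal,
  hence \<open>W\<^sub>i\<close> has an orthonormal basis each of whose members is orthogonal to at least one of them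
  (\<open>orthonormal_basis_avoiding_orthogonal_pair\<close>). Against that basis, adapted to the given
  pair, \<open>x\<close> and \<open>y\<close> have the same absolute inner products, and (3) applies.
\<close>

section \<open>Norm retrieval by vectors\<close>

lemma abs_inner_eq_iff_orthogonal:
  fixes x y b :: "'a::real_inner"
  shows "\<bar>x \<bullet> b\<bar> = \<bar>y \<bullet> b\<bar> \<longleftrightarrow> orthogonal (x - y) b \<or> orthogonal (x + y) b"
  by (auto simp: orthogonal_def inner_diff_left inner_add_left abs_eq_iff)

lemma norm_eq_iff_orthogonal_diff_add:
  fixes x y :: "'a::real_inner"
  shows "norm x = norm y \<longleftrightarrow> orthogonal (x - y) (x + y)"
  by (simp add: norm_eq orthogonal_def algebra_simps inner_commute)

lemma orthogonal_comp_span: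
  "(span A)\<^sup>\<bottom> = {x. \<forall>a\<in>A. orthogonal x a}"
  unfolding orthogonal_comp_def
  by (auto intro: span_base orthogonal_to_span simp: orthogonal_commute)

text \<open>
  The substitution \<open>u = x - y\<close>, \<open>v = x + y\<close> turns pairs with equal measurements into pairs
  \<open>u \<in> (span \<psi>(S))\<^sup>\<bottom>\<close>, \<open>v \<in> (span \<psi>(K - S))\<^sup>\<bottom>\<close>, where \<open>S\<close> collects the indices at which the
  measurements agree without a change of sign. It is invertible, which gives both directions.
\<close>

lemma vectors_norm_retrieval_iff_orthogonal_comps:
  fixes \<psi> :: "'k \<Rightarrow> 'a::euclidean_space"
  shows "vectors_norm_retrieval K \<psi> \<longleftrightarrow>
    (\<forall>S\<subseteq>K. orthogonal_sets ((span (\<psi> ` S))\<^sup>\<bottom>) ((span (\<psi> ` (K - S)))\<^sup>\<bottom>))"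
proof
  assume nr: "vectors_norm_retrieval K \<psi>"
  show "\<forall>S\<subseteq>K. orthogonal_sets ((span (\<psi> ` S))\<^sup>\<bottom>) ((span (\<psi> ` (K - S)))\<^sup>\<bottom>)"
    unfolding orthogonal_sets_def
  proof (intro allI impI ballI)
    fix S u v
    assume u: "u \<in> (span (\<psi> ` S))\<^sup>\<bottom>" and v: "v \<in> (span (\<psi> ` (K - S)))\<^sup>\<bottom>"
    \<comment> \<open>The factor 1/2 of the inverse substitution is dropped: it only scales \<open>u\<close> and \<open>v\<close>.\<close>
    have diff: "(v + u) - (v - u) = 2 *\<^sub>R u" and add: "(v + u) + (v - u) = 2 *\<^sub>R v"
      by (simp_all add: scaleR_2)
    have "\<bar>(v + u) \<bullet> \<psi> k\<bar> = \<bar>(v - u) \<bullet> \<psi> k\<bar>" if "k \<in> K" for k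
      using u v that unfolding abs_inner_eq_iff_orthogonal diff add orthogonal_comp_span
      by (cases "k \<in> S") (auto simp: orthogonal_def)
    then have "norm (v + u) = norm (v - u)"
      using nr unfolding vectors_norm_retrieval_def by blast
    then show "orthogonal u v"
      unfolding norm_eq_iff_orthogonal_diff_add diff add by (simp add: orthogonal_def)
  qed
next
  assume orth: "\<forall>S\<subseteq>K. orthogonal_sets ((span (\<psi> ` S))\<^sup>\<bottom>) ((span (\<psi> ` (K - S)))\<^sup>\<bottom>)"
  show "vectors_norm_retrieval K \<psi>"
    unfolding vectors_norm_retrieval_def
  proof (intro allI impI)
    fix x y
    assume eq: "\<forall>k\<in>K. \<bar>x \<bullet> \<psi> k\<bar> = \<bar>y \<bullet> \<psi> k\<bar>"
    define S where "S = {k \<in> K. orthogonal (x - y) (\<psi> k)}"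
    have "x - y \<in> (span (\<psi> ` S))\<^sup>\<bottom>"
      by (auto simp: orthogonal_comp_span S_def)
    moreover have "x + y \<in> (span (\<psi> ` (K - S)))\<^sup>\<bottom>"
      using eq by (auto simp: orthogonal_comp_span S_def abs_inner_eq_iff_orthogonal)
    moreover have "S \<subseteq> K"
      by (auto simp: S_def)
    ultimately have "orthogonal (x - y) (x + y)"
      using orth unfolding orthogonal_sets_def by blast
    then show "norm x = norm y"
      by (simp add: norm_eq_iff_orthogonal_diff_add)
  qed
qed

section \<open>Projections and orthonormal bases\<close>

lemma inner_orthogonal_projection_onto:
  assumes "orthogonal_projection_onto W P" and "b \<in> W"
  shows "P x \<bullet> b = x \<bullet> b"
proof -
  have "orthogonal (x - P x) b"
    using assms unfolding orthogonal_projection_onto_def by blast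
  then show ?thesis
    by (simp add: orthogonal_def inner_diff_left)
qed

lemma orthonormal_basis_of_member:
  assumes "orthonormal_basis_of W J \<phi>" and "j \<in> J"
  shows "\<phi> j \<in> W"
  using assms by (auto simp: orthonormal_basis_of_def intro: span_base)

lemma parseval_orthonormal_basis_of:
  assumes basis: "orthonormal_basis_of W J \<phi>" and "finite J" and "x \<in> W"
  shows "(norm x)\<^sup>2 = (\<Sum>j\<in>J. (x \<bullet> \<phi> j)\<^sup>2)"
proof -
  have on: "\<phi> j \<bullet> \<phi> k = (if j = k then 1 else 0)" if "j \<in> J" "k \<in> J" for j k
    using basis that by (simp add: orthonormal_basis_of_def)
  have inj: "inj_on \<phi> J"
    by (rule inj_onI) (metis on zero_neq_one)
  have "(\<Sum>b\<in>\<phi> ` J. (x \<bullet> b) *\<^sub>R b) = x"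
  proof (rule orthonormal_basis_expand)
    show "pairwise orthogonal (\<phi> ` J)"
      by (auto simp: pairwise_def orthogonal_def on)
    show "norm b = 1" if "b \<in> \<phi> ` J" for b
      using that by (auto simp: norm_eq_1 on)
    show "x \<in> span (\<phi> ` J)"
      using basis \<open>x \<in> W\<close> by (simp add: orthonormal_basis_of_def)
  qed (use \<open>finite J\<close> in simp)
  then have "x = (\<Sum>j\<in>J. (x \<bullet> \<phi> j) *\<^sub>R \<phi> j)"
    by (simp add: sum.reindex[OF inj])
  then have "x \<bullet> x = x \<bullet> (\<Sum>j\<in>J. (x \<bullet> \<phi> j) *\<^sub>R \<phi> j)"
    by simp
  then show ?thesis
    unfolding power2_norm_eq_inner by (simp add: inner_sum_right power2_eq_square)
qed

lemma norm_projection_eq_if_abs_inner_eq: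
  assumes proj: "orthogonal_projection_onto W P"
    and basis: "orthonormal_basis_of W J \<phi>" and "finite J"
    and eq: "\<And>j. j \<in> J \<Longrightarrow> \<bar>x \<bullet> \<phi> j\<bar> = \<bar>y \<bullet> \<phi> j\<bar>"
  shows "norm (P x) = norm (P y)"
proof -
  have sq: "(norm (P z))\<^sup>2 = (\<Sum>j\<in>J. (z \<bullet> \<phi> j)\<^sup>2)" for z
  proof -
    have "P z \<in> W"
      using proj by (simp add: orthogonal_projection_onto_def)
    then show ?thesis
      using parseval_orthonormal_basis_of[OF basis \<open>finite J\<close>]
        inner_orthogonal_projection_onto[OF proj orthonormal_basis_of_member[OF basis]]
      by simp
  qed
  have "(norm (P x))\<^sup>2 = (norm (P y))\<^sup>2"
    unfolding sq by (intro sum.cong refl) (metis eq power2_abs)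
  then show ?thesis
    by simp
qed

text \<open>
  Extend \<open>{u, v}\<close> to an orthogonal spanning set of \<open>W\<close>, discard zero and normalise. Every member
  other than \<open>u\<close> is orthogonal to \<open>u\<close>, and \<open>u\<close> itself is orthogonal to \<open>v\<close>. Discarding zero
  only after the extension treats the degenerate cases \<open>u = 0\<close> and \<open>v = 0\<close> uniformly.
\<close>

lemma orthonormal_basis_avoiding_orthogonal_pair:
  fixes W :: "'a::euclidean_space set"
  assumes W: "subspace W" and u: "u \<in> W" and v: "v \<in> W" and uv: "orthogonal u v"
  obtains \<phi> :: "nat \<Rightarrow> 'a"
  where "orthonormal_basis_of W {1..dim W} \<phi>"
    and "\<And>j. j \<in> {1..dim W} \<Longrightarrow> orthogonal u (\<phi> j) \<or> orthogonal v (\<phi> j)"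
proof -
  have "pairwise orthogonal {u, v}"
    using uv by (auto simp: pairwise_def orthogonal_commute)
  then obtain U where U: "pairwise orthogonal ({u, v} \<union> U)"
    and spanU: "span ({u, v} \<union> U) = span ({u, v} \<union> W)"
    using orthogonal_extension by blast
  define C where "C = ({u, v} \<union> U) - {0}"
  have orthC: "pairwise orthogonal C"
    using U unfolding C_def by (rule pairwise_mono) auto
  have "{u, v} \<union> W = W"
    using u v by auto
  then have spanC: "span C = W"
    using spanU W unfolding C_def span_delete_0 by (simp add: span_eq_iff)
  have "independent C"
    using orthC by (rule pairwise_orthogonal_independent) (simp add: C_def)
  then have "card C = dim W"
    using spanC dim_eq_card by (metis span_span)
  then obtain h where h: "bij_betw h {1..dim W} C"
    using pairwise_orthogonal_imp_finite[OF orthC] ex_bij_betw_nat_finite_1 by metis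
  define \<phi> where "\<phi> j = (1 / norm (h j)) *\<^sub>R h j" for j
  have hC: "h j \<in> C" if "j \<in> {1..dim W}" for j
    using h that by (auto simp: bij_betw_def)
  have h_neq: "h j \<noteq> h k" if "j \<in> {1..dim W}" "k \<in> {1..dim W}" "j \<noteq> k" for j k
    using h that by (auto simp: bij_betw_def inj_on_def)
  have "\<phi> j \<bullet> \<phi> k = (if j = k then 1 else 0)" if jk: "j \<in> {1..dim W}" "k \<in> {1..dim W}" for j k
  proof (cases "j = k")
    case True
    have "h k \<noteq> 0"
      using hC[OF jk(2)] by (simp add: C_def)
    then show ?thesis
      using True by (simp add: \<phi>_def power2_norm_eq_inner[symmetric] power2_eq_square)
  next
    case False
    then have "orthogonal (h j) (h k)"
      using orthC hC[OF jk(1)] hC[OF jk(2)] h_neq[OF jk] by (simp add: pairwise_def)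
    then show ?thesis
      using False by (simp add: \<phi>_def orthogonal_def)
  qed
  moreover have "span (\<phi> ` {1..dim W}) = W"
  proof -
    have "\<phi> ` {1..dim W} = (\<lambda>b. (1 / norm b) *\<^sub>R b) ` C"
      using h by (auto simp: \<phi>_def bij_betw_def)
    also have "span \<dots> = span C"
      by (rule span_image_scale) (use pairwise_orthogonal_imp_finite[OF orthC] in \<open>auto simp: C_def\<close>)
    finally show ?thesis
      using spanC by simp
  qed
  ultimately have "orthonormal_basis_of W {1..dim W} \<phi>"
    by (simp add: orthonormal_basis_of_def)
  moreover have "orthogonal u (\<phi> j) \<or> orthogonal v (\<phi> j)" if "j \<in> {1..dim W}" for j
  proof (cases "h j = u")
    case True
    then show ?thesis
      using uv by (simp add: \<phi>_def orthogonal_clauses orthogonal_commute)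
  next
    case False
    then have "orthogonal u (h j)"
      using U hC[OF that] by (auto simp: C_def pairwise_def)
    then show ?thesis
      by (simp add: \<phi>_def orthogonal_clauses)
  qed
  ultimately show ?thesis
    using that by blast
qed

text \<open>
  The basis depends on \<open>x\<close> and \<open>y\<close>: this is why (3) has to quantify over all choices of bases.
\<close>

lemma orthonormal_basis_with_equal_abs_inner:
  fixes W :: "'a::euclidean_space set"
  assumes W: "subspace W" and proj: "orthogonal_projection_onto W P"
    and eq: "norm (P x) = norm (P y)"
  obtains \<phi> :: "nat \<Rightarrow> 'a"
  where "orthonormal_basis_of W {1..dim W} \<phi>"
    and "\<And>j. j \<in> {1..dim W} \<Longrightarrow> \<bar>x \<bullet> \<phi> j\<bar> = \<bar>y \<bullet> \<phi> j\<bar>"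
proof -
  have "P x \<in> W" "P y \<in> W"
    using proj by (simp_all add: orthogonal_projection_onto_def)
  then have "P x - P y \<in> W" "P x + P y \<in> W"
    using W by (simp_all add: subspace_diff subspace_add)
  moreover have "orthogonal (P x - P y) (P x + P y)"
    using eq by (simp add: norm_eq_iff_orthogonal_diff_add)
  ultimately obtain \<phi> :: "nat \<Rightarrow> 'a" where basis: "orthonormal_basis_of W {1..dim W} \<phi>"
    and orth: "\<And>j. j \<in> {1..dim W} \<Longrightarrow>
      orthogonal (P x - P y) (\<phi> j) \<or> orthogonal (P x + P y) (\<phi> j)"
    using orthonormal_basis_avoiding_orthogonal_pair[OF W] by blast
  have "\<bar>x \<bullet> \<phi> j\<bar> = \<bar>y \<bullet> \<phi> j\<bar>" if "j \<in> {1..dim W}" for j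
    using orth[OF that] inner_orthogonal_projection_onto[OF proj orthonormal_basis_of_member[OF basis that]]
    by (simp flip: abs_inner_eq_iff_orthogonal)
  with basis show ?thesis
    using that by blast
qed

section \<open>The equivalence\<close>

theorem theorem5p2:
  fixes M :: nat
    and W :: "nat \<Rightarrow> (real ^ 'n) set"
    and P :: "nat \<Rightarrow> real ^ 'n \<Rightarrow> real ^ 'n"
  assumes subsp: "\<And>i. i \<in> {1..M} \<Longrightarrow> subspace (W i)"
    and proj: "\<And>i. i \<in> {1..M} \<Longrightarrow> orthogonal_projection_onto (W i) (P i)"
  shows "(projections_norm_retrieval {1..M} P \<longleftrightarrow>
           (\<forall>\<phi> :: nat \<Rightarrow> nat \<Rightarrow> real ^ 'n.
              (\<forall>i\<in>{1..M}. orthonormal_basis_of (W i) {1..dim (W i)} (\<phi> i)) \<longrightarrow>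
              (\<forall>S \<subseteq> basis_index_set M W.
                 orthogonal_sets
                   ((span ((\<lambda>(i, j). \<phi> i j) ` S))\<^sup>\<bottom>)
                   ((span ((\<lambda>(i, j). \<phi> i j) ` (basis_index_set M W - S)))\<^sup>\<bottom>))))
       \<and> (projections_norm_retrieval {1..M} P \<longleftrightarrow>
           (\<forall>\<phi> :: nat \<Rightarrow> nat \<Rightarrow> real ^ 'n.
              (\<forall>i\<in>{1..M}. orthonormal_basis_of (W i) {1..dim (W i)} (\<phi> i)) \<longrightarrow>
              vectors_norm_retrieval (basis_index_set M W) (\<lambda>(i, j). \<phi> i j)))"
proof -
  have proj_iff_vect: "projections_norm_retrieval {1..M} P \<longleftrightarrow>
    (\<forall>\<phi> :: nat \<Rightarrow> nat \<Rightarrow> real ^ 'n.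
      (\<forall>i\<in>{1..M}. orthonormal_basis_of (W i) {1..dim (W i)} (\<phi> i)) \<longrightarrow>
      vectors_norm_retrieval (basis_index_set M W) (\<lambda>(i, j). \<phi> i j))"
    (is "?proj \<longleftrightarrow> ?vect")
  proof
    assume nr: ?proj
    show ?vect
      unfolding vectors_norm_retrieval_def
    proof (intro allI impI)
      fix \<phi> :: "nat \<Rightarrow> nat \<Rightarrow> real ^ 'n" and x y :: "real ^ 'n"
      assume basis: "\<forall>i\<in>{1..M}. orthonormal_basis_of (W i) {1..dim (W i)} (\<phi> i)"
        and eq: "\<forall>k\<in>basis_index_set M W.
          \<bar>x \<bullet> (case k of (i, j) \<Rightarrow> \<phi> i j)\<bar> = \<bar>y \<bullet> (case k of (i, j) \<Rightarrow> \<phi> i j)\<bar>"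
      have "norm (P i x) = norm (P i y)" if i: "i \<in> {1..M}" for i
      proof (rule norm_projection_eq_if_abs_inner_eq[OF proj[OF i]])
        show "orthonormal_basis_of (W i) {1..dim (W i)} (\<phi> i)"
          using basis i by blast
        show "\<bar>x \<bullet> \<phi> i j\<bar> = \<bar>y \<bullet> \<phi> i j\<bar>" if "j \<in> {1..dim (W i)}" for j
          using eq i that by (auto simp: basis_index_set_def)
      qed simp
      then show "norm x = norm y"
        using nr unfolding projections_norm_retrieval_def by blast
    qed
  next
    assume nr: ?vect
    show ?proj
      unfolding projections_norm_retrieval_def
    proof (intro allI impI)
      fix x y :: "real ^ 'n"
      assume eq: "\<forall>i\<in>{1..M}. norm (P i x) = norm (P i y)"
      have "\<forall>i\<in>{1..M}. \<exists>b :: nat \<Rightarrow> real ^ 'n. orthonormal_basis_of (W i) {1..dim (W i)} b \<and>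
          (\<forall>j\<in>{1..dim (W i)}. \<bar>x \<bullet> b j\<bar> = \<bar>y \<bullet> b j\<bar>)"
      proof
        fix i
        assume i: "i \<in> {1..M}"
        obtain b :: "nat \<Rightarrow> real ^ 'n" where "orthonormal_basis_of (W i) {1..dim (W i)} b"
          and "\<And>j. j \<in> {1..dim (W i)} \<Longrightarrow> \<bar>x \<bullet> b j\<bar> = \<bar>y \<bullet> b j\<bar>"
          by (rule orthonormal_basis_with_equal_abs_inner[OF subsp[OF i] proj[OF i] bspec[OF eq i]])
            blast
        then show "\<exists>b :: nat \<Rightarrow> real ^ 'n. orthonormal_basis_of (W i) {1..dim (W i)} b \<and>
            (\<forall>j\<in>{1..dim (W i)}. \<bar>x \<bullet> b j\<bar> = \<bar>y \<bullet> b j\<bar>)"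
          by blast
      qed
      from bchoice[OF this] obtain \<phi> :: "nat \<Rightarrow> nat \<Rightarrow> real ^ 'n"
        where basis: "\<forall>i\<in>{1..M}. orthonormal_basis_of (W i) {1..dim (W i)} (\<phi> i)"
          and abs: "\<forall>i\<in>{1..M}. \<forall>j\<in>{1..dim (W i)}. \<bar>x \<bullet> \<phi> i j\<bar> = \<bar>y \<bullet> \<phi> i j\<bar>"
        by blast
      have "vectors_norm_retrieval (basis_index_set M W) (\<lambda>(i, j). \<phi> i j)"
        using nr basis by blast
      moreover have "\<forall>k\<in>basis_index_set M W.
          \<bar>x \<bullet> (case k of (i, j) \<Rightarrow> \<phi> i j)\<bar> = \<bar>y \<bullet> (case k of (i, j) \<Rightarrow> \<phi> i j)\<bar>"
        using abs by (auto simp: basis_index_set_def)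
      ultimately show "norm x = norm y"
        unfolding vectors_norm_retrieval_def by blast
    qed
  qed
  show ?thesis
    by (rule conjI[OF proj_iff_vect[unfolded vectors_norm_retrieval_iff_orthogonal_comps] proj_iff_vect])
qed

end
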